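(* Let $G$ be a weighted undirected graph on $N$ vertices with combinatorial Laplacian eigenvalues $\lambda_1,\dots,\lambda_N$, let $T\ge 1$ be the number of time steps, and let $\omega_k = 2\pi(k-1)/T$ for $k=1,\dots,T$. Let $\{h_z(\lambda,\omega)\}_{z\in\mathcal{Z}_\lambda\times\mathcal{Z}_\omega}$ (with $\mathcal{Z}_\lambda\times\mathcal{Z}_\omega\subset\mathbb{R}^2$ finite) be the kernels of a time-vertex dictionary $\mathcal{D}_h$, with associated analysis operator $D_h$, and set $$A=\min_{\ell,k}\sum_{z}|h_z(\lambda_\ell,\omega_k)|^2,\qquad B=\max_{\ell,k}\sum_{z}|h_z(\lambda_\ell,\omega_k)|^2,$$ where $\ell$ ranges over $1,\dots,N$, $k$ over $1,\dots,T$, and $z$ over $\mathcal{Z}_\lambda\times\mathcal{Z}_\omega$. If $0<A\le B<\infty$, then $D_h$ is a frame in the sense that $$A\,\|X\|_F^2\;\le\;\|D_h\{X\}\|_F^2\;\le\;B\,\|X\|_F^2$$ for every time-vertex signal $X\in\mathbb{R}^{N\times T}$.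
   Context: **Graph.** $G=(\mathcal{V},\mathcal{E},W_G)$ is a finite undirected graph with $N$ vertices and symmetric nonnegative $N\times N$ weight matrix $W_G$. Its combinatorial Laplacian is $L_G=D_G-W_G$, where $D_G$ is the diagonal degree matrix. Write $L_G=U_G\Lambda_G U_G^{*}$ with $U_G$ having orthonormal columns $u_1,\dots,u_N$ (eigenvectors) and $\Lambda_G=\mathrm{diag}(\lambda_1,\dots,\lambda_N)$, $\lambda_\ell\ge 0$. **Time-vertex signals.** A time-vertex signal is a matrix $X\in\mathbb{R}^{N\times T}$ whose entry $X(n,t)$ is the value at vertex $n\in\{1,\dots,N\}$ and time $t\in\{1,\dots,T\}$. $\|\cdot\|_F$ is the Frobenius norm, and $\langle X,Y\rangle=\sum_{n,t}X(n,t)\overline{Y(n,t)}$. The angular frequencies are $\omega_k=2\pi(k-1)/T$, $k=1,\dots,T$. **Joint localization operator.** For a kernel $h$ (a complex-valued function $h(\lambda,\omega)$ of graph frequency $\lambda$ and angular frequency $\omega$), a vertex $m$ and a time $\tau$, the localized atom $\mathcal{T}^J_{m,\tau}h\in\mathbb{C}^{N\times T}$ is the result of filtering, with joint spectral response $h$, the Kronecker delta located at vertex $m$ and time $\tau$: $$(\mathcal{T}^J_{m,\tau}h)(n,t)=\frac1T\sum_{\ell=1}^{N}\sum_{k=1}^{T}h(\lambda_\ell,\omega_k)\,\overline{u_\ell(m)}\,u_\ell(n)\,e^{j\omega_k(t-\tau)},$$ where $j$ is the imaginary unit. **Time-vertex dictionary.** Given a mother kernel $h$ and a transformation $s_z(\cdot,\cdot)$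 of the pair $(\lambda,\omega)$ (for example a shift or a scaling) parametrized by $z=[z_\lambda,z_\omega]$ in a finite set $\mathcal{Z}_\lambda\times\mathcal{Z}_\omega\subset\mathbb{R}^2$, the kernels are $h_z(\lambda,\omega)=h(s_z(\lambda,\omega))$, and the dictionary is $$\mathcal{D}_h=\{\mathcal{T}^J_{m,\tau}h_z:\ m\in\{1,\dots,N\},\ \tau\in\{1,\dots,T\},\ z\in\mathcal{Z}_\lambda\times\mathcal{Z}_\omega\}.$$ **Analysis operator.** $D_h\{X\}(m,\tau,z)=\langle X,\mathcal{T}^J_{m,\tau}h_z\rangle$ for all $m,\tau,z$, and $$\|D_h\{X\}\|_F^2=\sum_{m=1}^{N}\sum_{\tau=1}^{T}\sum_{z\in\mathcal{Z}_\lambda\times\mathcal{Z}_\omega}|D_h\{X\}(m,\tau,z)|^2.$$ *)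

theory Defs
  imports Complex_Main "Jordan_Normal_Form.Schur_Decomposition"
begin

text \<open>
  Vertices, times, eigenvalue indices and frequency indices are numbered from 0, following the
  matrix library: vertex \<open>n < N\<close> and time \<open>t < T\<close> stand for the vertex \<open>n + 1\<close> and the time
  \<open>t + 1\<close> of the usual numbering, and frequency index \<open>k < T\<close> for \<open>k + 1\<close>.  The atoms depend on
  times only through differences, so the numbering does not affect them.
\<close>

definition weighted_graph :: "nat \<Rightarrow> real mat \<Rightarrow> bool" where
  "weighted_graph N W \<longleftrightarrow>
     W \<in> carrier_mat N N \<and> transpose_mat W = W \<and> (\<forall>i<N. \<forall>j<N. W $$ (i, j) \<ge> 0)"

definition degree_matrix :: "real mat \<Rightarrow> real mat" where
  "degree_matrix W = mat_diag (dim_row W) (\<lambda>i. \<Sum>j<dim_col W. W $$ (i, j))"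

definition laplacian :: "real mat \<Rightarrow> real mat" where
  "laplacian W = degree_matrix W - W"

text \<open>Column \<open>l\<close> of \<open>U\<close> is the eigenvector for the eigenvalue \<open>lam l\<close>; values of \<open>lam\<close> at
  indices \<open>\<ge> N\<close> are irrelevant.\<close>

definition laplacian_eigendecomposition ::
    "nat \<Rightarrow> real mat \<Rightarrow> complex mat \<Rightarrow> (nat \<Rightarrow> real) \<Rightarrow> bool" where
  "laplacian_eigendecomposition N W U lam \<longleftrightarrow>
     U \<in> carrier_mat N N \<and>
     mat_adjoint U * U = 1\<^sub>m N \<and>
     map_mat complex_of_real (laplacian W)
       = U * mat_diag N (\<lambda>l. complex_of_real (lam l)) * mat_adjoint U"

definition angular_freq :: "nat \<Rightarrow> nat \<Rightarrow> real" where
  "angular_freq T k = 2 * pi * real k / real T"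

definition joint_localization ::
    "nat \<Rightarrow> nat \<Rightarrow> complex mat \<Rightarrow> (nat \<Rightarrow> real) \<Rightarrow> (real \<times> real \<Rightarrow> complex) \<Rightarrow> nat \<Rightarrow> nat
      \<Rightarrow> complex mat" where
  "joint_localization N T U lam h m \<tau> = Matrix.mat N T (\<lambda>(n, t).
     1 / of_nat T * (\<Sum>l<N. \<Sum>k<T.
       h (lam l, angular_freq T k) * cnj (U $$ (m, l)) * U $$ (n, l)
         * exp (\<i> * complex_of_real (angular_freq T k * (real t - real \<tau>)))))"

definition dict_kernel ::
    "(real \<times> real \<Rightarrow> complex) \<Rightarrow> (real \<times> real \<Rightarrow> real \<times> real \<Rightarrow> real \<times> real) \<Rightarrow> real \<times> real
      \<Rightarrow> real \<times> real \<Rightarrow> complex" where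
  "dict_kernel h s z p = h (s z p)"

definition frob_inner :: "complex mat \<Rightarrow> complex mat \<Rightarrow> complex" where
  "frob_inner X Y = (\<Sum>n<dim_row X. \<Sum>t<dim_col X. X $$ (n, t) * cnj (Y $$ (n, t)))"

definition frob_norm :: "real mat \<Rightarrow> real" where
  "frob_norm X = sqrt (\<Sum>n<dim_row X. \<Sum>t<dim_col X. \<bar>X $$ (n, t)\<bar>\<^sup>2)"

definition analysis_op ::
    "nat \<Rightarrow> nat \<Rightarrow> complex mat \<Rightarrow> (nat \<Rightarrow> real) \<Rightarrow> (real \<times> real \<Rightarrow> complex)
      \<Rightarrow> (real \<times> real \<Rightarrow> real \<times> real \<Rightarrow> real \<times> real) \<Rightarrow> real mat
      \<Rightarrow> nat \<times> nat \<times> (real \<times> real) \<Rightarrow> complex" where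
  "analysis_op N T U lam h s X = (\<lambda>(m, \<tau>, z).
     frob_inner (map_mat complex_of_real X)
       (joint_localization N T U lam (dict_kernel h s z) m \<tau>))"

definition coeff_norm ::
    "nat \<Rightarrow> nat \<Rightarrow> (real \<times> real) set \<Rightarrow> (nat \<times> nat \<times> (real \<times> real) \<Rightarrow> complex) \<Rightarrow> real" where
  "coeff_norm N T Z C = sqrt (\<Sum>m<N. \<Sum>\<tau><T. \<Sum>z\<in>Z. (cmod (C (m, \<tau>, z)))\<^sup>2)"

end

theory Submission
  imports Defs
begin

text \<open>
  The vectors \<open>\<phi>\<^bsub>l,k\<^esub>(n, t) = u\<^sub>l(n) e\<^bsup>i \<omega>\<^sub>k t\<^esup> / \<surd>T\<close> form an orthonormal basis of the time-vertex
  signals.  An atom is \<open>\<Sum>\<^bsub>l,k\<^esub> h\<^sub>z(\<lambda>\<^sub>l, \<omega>\<^sub>k) cnj (\<phi>\<^bsub>l,k\<^esub>(m, \<tau>)) \<phi>\<^bsub>l,k\<^esub>\<close>, so for fixed \<open>z\<close> the analysis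
  coefficients are the expansion, in the same basis, of the joint Fourier transform \<open>FX\<close> of \<open>X\<close> multiplied
  by \<open>cnj h\<^sub>z\<close>.  Parseval, applied to this expansion and to \<open>X\<close>, turns the coefficient energy into
  \<open>\<Sum>\<^bsub>l,k\<^esub> (\<Sum>\<^sub>z \<bar>h\<^sub>z(\<lambda>\<^sub>l, \<omega>\<^sub>k)\<bar>\<^sup>2) \<bar>FX(l, k)\<bar>\<^sup>2\<close> and the norm of \<open>X\<close> into the same sum without the weights.
\<close>

text \<open>Here \<open>b i a\<close> is coordinate \<open>i\<close> of vector \<open>a\<close>.
  Writing a squared modulus as w * cnj w expands the left side into a double sum over
  \<open>J\<close>; summing over \<open>I\<close> first leaves the Gram matrix of the vectors, which
  is the identity.\<close>

lemma parseval_finite: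
  fixes b :: "'i \<Rightarrow> 'j \<Rightarrow> complex"
  assumes "finite J"
    and orth: "\<And>a a'. a \<in> J \<Longrightarrow> a' \<in> J \<Longrightarrow> (\<Sum>i\<in>I. b i a * cnj (b i a')) = of_bool (a = a')"
  shows "(\<Sum>i\<in>I. (cmod (\<Sum>a\<in>J. c a * b i a))\<^sup>2) = (\<Sum>a\<in>J. (cmod (c a))\<^sup>2)"
proof -
  have "complex_of_real (\<Sum>i\<in>I. (cmod (\<Sum>a\<in>J. c a * b i a))\<^sup>2)
      = (\<Sum>i\<in>I. \<Sum>a\<in>J. \<Sum>a'\<in>J. (c a * cnj (c a')) * (b i a * cnj (b i a')))"
    by (simp only: of_real_sum complex_norm_square cnj_sum complex_cnj_mult sum_product mult_ac)
  also have "\<dots> = (\<Sum>a\<in>J. \<Sum>a'\<in>J. \<Sum>i\<in>I. (c a * cnj (c a')) * (b i a * cnj (b i a')))"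
    by (subst sum.swap, rule sum.cong[OF refl], rule sum.swap)
  also have "\<dots> = (\<Sum>a\<in>J. \<Sum>a'\<in>J. if a = a' then c a * cnj (c a') else 0)"
    by (intro sum.cong refl) (simp add: orth flip: sum_distrib_left)
  also have "\<dots> = complex_of_real (\<Sum>a\<in>J. (cmod (c a))\<^sup>2)"
    using \<open>finite J\<close> by (simp add: complex_norm_square flip: of_real_power)
  finally show ?thesis
    by (simp only: of_real_eq_iff)
qed

text \<open>The unitary DFT matrix. It is symmetric in \<open>k\<close> and \<open>t\<close>, so
  orthonormality in one index gives it in the other.\<close>

definition fourier :: "nat \<Rightarrow> nat \<Rightarrow> nat \<Rightarrow> complex" where
  "fourier T k t = cis (2 * pi * (real k * real t) / real T) / complex_of_real (sqrt (real T))"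

lemma fourier_commute: "fourier T k t = fourier T t k"
  by (simp add: fourier_def mult.commute)

lemma fourier_mult_cnj:
  assumes "T \<ge> 1"
  shows "fourier T k t * cnj (fourier T k \<tau>)
    = 1 / of_nat T * exp (\<i> * complex_of_real (angular_freq T k * (real t - real \<tau>)))"
proof -
  have "complex_of_real (sqrt (real T)) * complex_of_real (sqrt (real T)) = of_nat T"
    by (simp flip: of_real_mult)
  moreover have "2 * pi * (real k * real t) / real T + - (2 * pi * (real k * real \<tau>) / real T)
      = angular_freq T k * (real t - real \<tau>)"
    by (simp add: angular_freq_def diff_divide_distrib algebra_simps)
  ultimately show ?thesis
    unfolding cis_conv_exp[symmetric] by (simp add: fourier_def cis_cnj cis_mult)
qed

lemma cis_eq_1_iff_int: "cis (2 * pi * x) = 1 \<longleftrightarrow> x \<in> \<int>"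
proof
  assume "cis (2 * pi * x) = 1"
  then have "cos (2 * pi * x) = 1"
    by (metis cis.sel(1) one_complex.sel(1))
  then obtain n :: int where "2 * pi * x = of_int n * 2 * pi"
    by (auto simp: cos_one_2pi_int)
  then have "x = of_int n" by simp
  then show "x \<in> \<int>" by simp
next
  assume "x \<in> \<int>"
  then show "cis (2 * pi * x) = 1" by (auto simp: cis_multiple_2pi)
qed

text \<open>The sum is a geometric series whose ratio \<open>w\<close> is a T-th root of unity,
  equal to 1 exactly when k = k'.\<close>

lemma fourier_orthonormal:
  assumes "k < T" "k' < T"
  shows "(\<Sum>t<T. fourier T k t * cnj (fourier T k' t)) = of_bool (k = k')"
proof -
  define w where "w = cis (2 * pi * ((real k - real k') / real T))"
  have T: "real T > 0" using assms by simp
  have sq: "complex_of_real (sqrt (real T)) * complex_of_real (sqrt (real T)) = of_nat T"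
    by (simp flip: of_real_mult)
  have "fourier T k t * cnj (fourier T k' t) = w ^ t / of_nat T" for t
    unfolding w_def fourier_def Complex.DeMoivre
    by (simp add: cis_cnj cis_mult sq) (simp add: diff_divide_distrib algebra_simps)
  then have eq: "(\<Sum>t<T. fourier T k t * cnj (fourier T k' t)) = (\<Sum>t<T. w ^ t) / of_nat T"
    by (simp add: sum_divide_distrib)
  show ?thesis
  proof (cases "k = k'")
    case True
    then show ?thesis using eq T by (simp add: w_def)
  next
    case False
    \<comment> \<open>The quotient lies strictly between -1 and 1 and is nonzero.\<close>
    have "(real k - real k') / real T \<notin> \<int>"
    proof
      assume "(real k - real k') / real T \<in> \<int>"
      then obtain n :: int where n: "(real k - real k') / real T = of_int n"
        by (auto elim: Ints_cases)
      have "\<bar>(real k - real k') / real T\<bar> < 1"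
        using assms by (simp add: abs_if field_simps)
      then have "n = 0" using n by linarith
      then show False using n False T by simp
    qed
    then have "w \<noteq> 1" unfolding w_def cis_eq_1_iff_int .
    \<comment> \<open>Since k - k' is an integer, \<open>w ^ T\<close> is 1 and the numerator of the
      closed form of the geometric sum vanishes.\<close>
    moreover have "w ^ T = cis (2 * pi * (real k - real k'))"
      unfolding w_def Complex.DeMoivre using T by simp
    then have "w ^ T = 1" by (simp add: cis_eq_1_iff_int)
    ultimately show ?thesis using eq False by (simp add: geometric_sum)
  qed
qed

text \<open>The frequency pair comes first, the vertex-time pair second. With pairs as indices,
  either argument can play the role of \<open>I\<close> or \<open>J\<close> in
  \<open>parseval_finite\<close>.\<close>

definition joint_basis :: "complex mat \<Rightarrow> nat \<Rightarrow> nat \<times> nat \<Rightarrow> nat \<times> nat \<Rightarrow> complex" where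
  "joint_basis U T lk nt = U $$ (fst nt, fst lk) * fourier T (snd lk) (snd nt)"

lemma unitary_columns:
  assumes "U \<in> carrier_mat N N" "mat_adjoint U * U = 1\<^sub>m N" "l < N" "l' < N"
  shows "(\<Sum>n<N. U $$ (n, l) * cnj (U $$ (n, l'))) = of_bool (l = l')"
proof -
  have "(mat_adjoint U * U) $$ (l', l) = (\<Sum>n<N. U $$ (n, l) * cnj (U $$ (n, l')))"
    using assms(1,3,4) by (auto simp: scalar_prod_def mat_adjoint_def mat_of_rows_def atLeast0LessThan
        mult.commute intro!: sum.cong)
  then show ?thesis using assms(2-4) by auto
qed

text \<open>For square matrices a left inverse is also a right inverse.\<close>

lemma unitary_rows:
  assumes "U \<in> carrier_mat N N" "mat_adjoint U * U = 1\<^sub>m N" "m < N" "n < N"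
  shows "(\<Sum>l<N. U $$ (m, l) * cnj (U $$ (n, l))) = of_bool (m = n)"
proof -
  have "mat_adjoint U \<in> carrier_mat N N" using assms(1) by (simp add: mat_adjoint_def mat_of_rows_def)
  then have "U * mat_adjoint U = 1\<^sub>m N"
    using mat_mult_left_right_inverse assms(1,2) by blast
  moreover have "(U * mat_adjoint U) $$ (m, n) = (\<Sum>l<N. U $$ (m, l) * cnj (U $$ (n, l)))"
    using assms(1,3,4) by (auto simp: scalar_prod_def mat_adjoint_def mat_of_rows_def atLeast0LessThan
        intro!: sum.cong)
  ultimately show ?thesis using assms(3,4) by auto
qed

lemma joint_basis_orthonormal:
  assumes "U \<in> carrier_mat N N" "mat_adjoint U * U = 1\<^sub>m N"
    and "p \<in> {..<N} \<times> {..<T}" "q \<in> {..<N} \<times> {..<T}"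
  shows "(\<Sum>x\<in>{..<N} \<times> {..<T}. joint_basis U T p x * cnj (joint_basis U T q x)) = of_bool (p = q)"
proof -
  have "(\<Sum>x\<in>{..<N} \<times> {..<T}. joint_basis U T p x * cnj (joint_basis U T q x))
      = (\<Sum>n<N. U $$ (n, fst p) * cnj (U $$ (n, fst q)))
        * (\<Sum>t<T. fourier T (snd p) t * cnj (fourier T (snd q) t))"
    unfolding sum_product sum.cartesian_product
    by (intro sum.cong) (auto simp: joint_basis_def)
  then show ?thesis
    using assms by (auto simp: unitary_columns fourier_orthonormal prod_eq_iff)
qed

text \<open>The sum factors into a graph part and a time part; the symmetry of
  \<open>fourier\<close> turns the sum over frequencies into one over times.\<close>

lemma joint_basis_complete:
  assumes "U \<in> carrier_mat N N" "mat_adjoint U * U = 1\<^sub>m N"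
    and "x \<in> {..<N} \<times> {..<T}" "y \<in> {..<N} \<times> {..<T}"
  shows "(\<Sum>p\<in>{..<N} \<times> {..<T}. joint_basis U T p x * cnj (joint_basis U T p y)) = of_bool (x = y)"
proof -
  have "(\<Sum>p\<in>{..<N} \<times> {..<T}. joint_basis U T p x * cnj (joint_basis U T p y))
      = (\<Sum>l<N. U $$ (fst x, l) * cnj (U $$ (fst y, l)))
        * (\<Sum>k<T. fourier T (snd x) k * cnj (fourier T (snd y) k))"
    unfolding sum_product sum.cartesian_product
    by (intro sum.cong)
      (auto simp: joint_basis_def fourier_commute[of T "snd x"] fourier_commute[of T "snd y"])
  then show ?thesis
    using assms by (auto simp: unitary_rows fourier_orthonormal prod_eq_iff)
qed

definition joint_fourier :: "complex mat \<Rightarrow> nat \<Rightarrow> nat \<Rightarrow> real mat \<Rightarrow> nat \<times> nat \<Rightarrow> complex" where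
  "joint_fourier U N T X p
     = (\<Sum>x\<in>{..<N} \<times> {..<T}. complex_of_real (X $$ x) * cnj (joint_basis U T p x))"

text \<open>The phase at t - \<tau> splits into a factor at t and a conjugate factor at \<tau>, each
  taking 1 / sqrt T from the prefactor 1 / T.\<close>

lemma joint_localization_eq:
  assumes "T \<ge> 1" "n < N" "t < T"
  shows "joint_localization N T U lam g m \<tau> $$ (n, t)
    = (\<Sum>p\<in>{..<N} \<times> {..<T}. g (lam (fst p), angular_freq T (snd p))
        * cnj (joint_basis U T p (m, \<tau>)) * joint_basis U T p (n, t))"
proof -
  have "g (lam l, angular_freq T k) * cnj (joint_basis U T (l, k) (m, \<tau>)) * joint_basis U T (l, k) (n, t)
      = g (lam l, angular_freq T k) * cnj (U $$ (m, l)) * U $$ (n, l)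
        * (fourier T k t * cnj (fourier T k \<tau>))" for l k
    by (simp add: joint_basis_def mult_ac)
  then show ?thesis
    using assms
    by (simp add: joint_localization_def fourier_mult_cnj sum.cartesian_product'
        sum_distrib_left mult_ac)
qed

text \<open>Conjugating the atom removes the conjugate from the factor at (m, \<tau>) and puts it on
  the kernel and on the factor at x; summing over x first then produces
  \<open>joint_fourier\<close>.\<close>

lemma frob_inner_localization:
  assumes "T \<ge> 1" "X \<in> carrier_mat N T"
  shows "frob_inner (map_mat complex_of_real X) (joint_localization N T U lam g m \<tau>)
    = (\<Sum>p\<in>{..<N} \<times> {..<T}. (cnj (g (lam (fst p), angular_freq T (snd p))) * joint_fourier U N T X p)
        * joint_basis U T p (m, \<tau>))"
proof -
  have "frob_inner (map_mat complex_of_real X) (joint_localization N T U lam g m \<tau>)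
      = (\<Sum>x\<in>{..<N} \<times> {..<T}. complex_of_real (X $$ x) * cnj (joint_localization N T U lam g m \<tau> $$ x))"
    using assms by (simp add: frob_inner_def sum.cartesian_product' joint_localization_def)
  also have "\<dots> = (\<Sum>x\<in>{..<N} \<times> {..<T}. \<Sum>p\<in>{..<N} \<times> {..<T}. complex_of_real (X $$ x)
      * (cnj (g (lam (fst p), angular_freq T (snd p))) * joint_basis U T p (m, \<tau>) * cnj (joint_basis U T p x)))"
    using assms(1) by (intro sum.cong refl) (auto simp: joint_localization_eq sum_distrib_left)
  finally show ?thesis
    by (subst (asm) sum.swap) (simp add: joint_fourier_def sum_distrib_left sum_distrib_right mult_ac)
qed

lemma frob_norm_eq_joint_fourier:
  assumes "U \<in> carrier_mat N N" "mat_adjoint U * U = 1\<^sub>m N" "X \<in> carrier_mat N T"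
  shows "(frob_norm X)\<^sup>2 = (\<Sum>p\<in>{..<N} \<times> {..<T}. (cmod (joint_fourier U N T X p))\<^sup>2)"
proof -
  \<comment> \<open>The transform uses conjugated basis entries, so here the vectors are indexed by
    vertex-time points and their Gram matrix is completeness with x and y exchanged.\<close>
  have "(\<Sum>p\<in>{..<N} \<times> {..<T}. cnj (joint_basis U T p x) * cnj (cnj (joint_basis U T p y))) = of_bool (x = y)"
    if "x \<in> {..<N} \<times> {..<T}" "y \<in> {..<N} \<times> {..<T}" for x y
    using joint_basis_complete[OF assms(1,2) that(2,1)] by (auto simp: mult.commute)
  then have "(\<Sum>p\<in>{..<N} \<times> {..<T}. (cmod (joint_fourier U N T X p))\<^sup>2)
      = (\<Sum>x\<in>{..<N} \<times> {..<T}. (cmod (complex_of_real (X $$ x)))\<^sup>2)"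
    unfolding joint_fourier_def by (intro parseval_finite) auto
  then show ?thesis
    using assms(3) by (simp add: frob_norm_def sum_nonneg sum.cartesian_product')
qed

lemma coeff_norm_eq_joint_fourier:
  assumes "U \<in> carrier_mat N N" "mat_adjoint U * U = 1\<^sub>m N" "X \<in> carrier_mat N T" "T \<ge> 1"
  shows "(coeff_norm N T Z (analysis_op N T U lam h s X))\<^sup>2
    = (\<Sum>p\<in>{..<N} \<times> {..<T}. (\<Sum>z\<in>Z. (cmod (dict_kernel h s z (lam (fst p), angular_freq T (snd p))))\<^sup>2)
        * (cmod (joint_fourier U N T X p))\<^sup>2)"
proof -
  let ?D = "analysis_op N T U lam h s X"
  have "(coeff_norm N T Z ?D)\<^sup>2 = (\<Sum>x\<in>{..<N} \<times> {..<T}. \<Sum>z\<in>Z. (cmod (?D (fst x, snd x, z)))\<^sup>2)"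
    by (simp add: coeff_norm_def sum_nonneg sum.cartesian_product')
  also have "\<dots> = (\<Sum>z\<in>Z. \<Sum>x\<in>{..<N} \<times> {..<T}. (cmod (?D (fst x, snd x, z)))\<^sup>2)"
    by (rule sum.swap)
  also have "\<dots> = (\<Sum>z\<in>Z. \<Sum>p\<in>{..<N} \<times> {..<T}. (cmod (cnj (dict_kernel h s z
      (lam (fst p), angular_freq T (snd p))) * joint_fourier U N T X p))\<^sup>2)"
    \<comment> \<open>Parseval for each fixed z, now with vectors indexed by frequency pairs and
      coordinates (m, \<tau>).\<close>
    unfolding analysis_op_def prod.case frob_inner_localization[OF assms(4,3)] prod.collapse
    by (intro sum.cong refl parseval_finite joint_basis_orthonormal[OF assms(1,2)]) auto
  also have "\<dots> = (\<Sum>p\<in>{..<N} \<times> {..<T}. \<Sum>z\<in>Z. (cmod (cnj (dict_kernel h s z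
      (lam (fst p), angular_freq T (snd p))) * joint_fourier U N T X p))\<^sup>2)"
    by (rule sum.swap)
  finally show ?thesis
    by (simp add: norm_mult power_mult_distrib sum_distrib_right)
qed

theorem theorem1:
  fixes N T :: nat
    and W :: "real mat"
    and U :: "complex mat"
    and lam :: "nat \<Rightarrow> real"
    and h :: "real \<times> real \<Rightarrow> complex"
    and s :: "real \<times> real \<Rightarrow> real \<times> real \<Rightarrow> real \<times> real"
    and Zl Zw :: "real set"
    and A B :: real
  assumes "weighted_graph N W"
    and "laplacian_eigendecomposition N W U lam"
    and "T \<ge> 1"
    and "finite (Zl \<times> Zw)"
    and "A = Min {\<Sum>z\<in>Zl \<times> Zw. (cmod (dict_kernel h s z (lam l, angular_freq T k)))\<^sup>2
                  | l k. l < N \<and> k < T}"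
    and "B = Max {\<Sum>z\<in>Zl \<times> Zw. (cmod (dict_kernel h s z (lam l, angular_freq T k)))\<^sup>2
                  | l k. l < N \<and> k < T}"
    and "0 < A" and "A \<le> B"
  shows "\<forall>X \<in> carrier_mat N T.
           A * (frob_norm X)\<^sup>2 \<le> (coeff_norm N T (Zl \<times> Zw) (analysis_op N T U lam h s X))\<^sup>2 \<and>
           (coeff_norm N T (Zl \<times> Zw) (analysis_op N T U lam h s X))\<^sup>2 \<le> B * (frob_norm X)\<^sup>2"
proof (intro ballI conjI)
  fix X :: "real mat" assume X: "X \<in> carrier_mat N T"
  have U: "U \<in> carrier_mat N N" "mat_adjoint U * U = 1\<^sub>m N"
    using assms(2) by (auto simp: laplacian_eigendecomposition_def)
  let ?g = "\<lambda>l k. \<Sum>z\<in>Zl \<times> Zw. (cmod (dict_kernel h s z (lam l, angular_freq T k)))\<^sup>2"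
  \<comment> \<open>As the image of a finite grid the set is finite, so \<open>Min\<close> and
    \<open>Max\<close> bound each of its members. An empty grid is harmless: bounds are claimed only
    at grid points.\<close>
  have img: "{?g l k | l k. l < N \<and> k < T} = (\<lambda>p. ?g (fst p) (snd p)) ` ({..<N} \<times> {..<T})"
    by force
  have bounds: "A \<le> ?g (fst p) (snd p)" "?g (fst p) (snd p) \<le> B" if "p \<in> {..<N} \<times> {..<T}" for p
    unfolding assms(5,6) img using that by (auto intro!: Min_le Max_ge)
  \<comment> \<open>Both sides are sums over the same frequency grid, compared term by term.\<close>
  show "A * (frob_norm X)\<^sup>2 \<le> (coeff_norm N T (Zl \<times> Zw) (analysis_op N T U lam h s X))\<^sup>2"
    unfolding frob_norm_eq_joint_fourier[OF U X] coeff_norm_eq_joint_fourier[OF U X assms(3)]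
      sum_distrib_left
    by (intro sum_mono mult_right_mono bounds) auto
  show "(coeff_norm N T (Zl \<times> Zw) (analysis_op N T U lam h s X))\<^sup>2 \<le> B * (frob_norm X)\<^sup>2"
    unfolding frob_norm_eq_joint_fourier[OF U X] coeff_norm_eq_joint_fourier[OF U X assms(3)]
      sum_distrib_left
    by (intro sum_mono mult_right_mono bounds) auto
qed

end
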